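(* Let $p_X$ be a p.m.f. on $\mathcal X$, $\mathscr W$ a compound class of channels, $R$ a rate, $\alpha\ge 0$, and $\Delta=\alpha-E_{sp}(R,p_X,\mathscr W)$. If $R\ge I(p_X,\mathscr W)$, then the thresholding rule $F^{L*}(t)\equiv\Delta$ is optimal, in the sense that it achieves the supremum $$E_\emptyset^L(R,p_X,\mathscr W,\alpha)=\sup_{F\in\mathcal F^L(R,p_X,\mathscr W,\alpha)}E_{r,|F^{-1}|^+}(R,p_X,\mathscr W)$$ while satisfying the constraint $E_{r,F^{L*}}(R,p_X,\mathscr W)\ge\alpha$, and the optimal error exponents are: incorrect-message exponent $E_{\mathrm i}(R,p_X,\mathscr W,\alpha)=E_{r,F^{L*}}(R,p_X,\mathscr W)=\Delta$ and erasure exponent $E_\emptyset^L(R,p_X,\mathscr W,\alpha)=0$.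
   Context: $\mathcal X,\mathcal Y$ are finite alphabets; logarithms are base 2; $|t|^+=\max(0,t)$; $H(p_X)$ is entropy; $0<R\le H(p_X)$. A channel is a conditional p.m.f. $p_{Y|X}$ from $\mathcal X$ to $\mathcal Y$. $\mathscr W$ is a nonempty connected set of channels for which the minima over $\mathscr W$ below are attained. $I(p_X,\tilde p_{Y|X})$ is the mutual information under input $p_X$ and channel $\tilde p_{Y|X}$; $I(p_X,\mathscr W)=\min_{p_{Y|X}\in\mathscr W}I(p_X,p_{Y|X})$; $D(\tilde p_{Y|X}\|p_{Y|X}|p_X)=\sum_x p_X(x) D(\tilde p_{Y|X}(\cdot|x)\|p_{Y|X}(\cdot|x))$. Sphere-packing exponents: $E_{sp}(R,p_X,p_{Y|X})=\min_{\tilde p_{Y|X}: I(p_X,\tilde p_{Y|X})\le R} D(\tilde p_{Y|X}\|p_{Y|X}|p_X)$ ($+\infty$ if the set is empty) and $E_{sp}(R,p_X,\mathscr W)=\min_{p_{Y|X}\in\mathscr W}E_{sp}(R,p_X,p_{Y|X})$. Modified random coding exponents: for a nondecreasing function $F$ on $[-R,H(p_X)-R]$, $E_{r,F}(R,p_X,\mathscr W)=\min_{p_{Y|X}\in\mathscr W}\min_{\tilde p_{Y|X}}[D(\tilde p_{Y|X}\|p_{Y|X}|p_X)+F(I(p_X,\tilde p_{Y|X})-R)]$. For nondecreasing $F$ the inverse is $F^{-1}(u)=\inf\{t\in[-R,H(p_X)-R]: F(t)\ge u\}$ with $\inf\emptyset=+\infty$ (the ordinary inverse on the range when $F$ is continuous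 and strictly increasing), and $E_{r,|F^{-1}|^+}$ is $E_{r,G}$ with $G(u)=|F^{-1}(u)|^+$. $\mathcal F^L(R,p_X,\mathscr W,\alpha)$ is the set of continuous, strictly increasing $F:[-R,H(p_X)-R]\to\mathbb R$ with $E_{r,F}(R,p_X,\mathscr W)\ge\alpha$. "$F^{L*}$ achieves the supremum" means the supremum equals $E_{r,|(F^{L*})^{-1}|^+}(R,p_X,\mathscr W)$ (a constant function is only a limit of strictly increasing ones). *)

theory Defs
  imports "HOL-Probability.Probability"
begin

text \<open>
  Alphabets are types of class \<open>finite\<close>, and a channel from \<open>'x\<close> to \<open>'y\<close> is a function
  \<open>'x \<Rightarrow> 'y pmf\<close>. Exponents are extended reals: divergences may be infinite and the infimum of
  the empty set is \<open>\<infinity>\<close>. Minima are written as infima; that minima over a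
  compound class are attained is a separate assumption, \<open>minima_attained\<close> below, while
  the inner minima, over all channels or over a closed set of channels, run over
  compact sets.
\<close>

type_synonym ('x, 'y) channel = "'x \<Rightarrow> 'y pmf"

definition pmf_entropy :: "'a pmf \<Rightarrow> real" where
  "pmf_entropy p = prob_space.entropy (measure_pmf p) 2 (count_space UNIV) (\<lambda>x. x)"

definition joint_pmf :: "'x pmf \<Rightarrow> ('x, 'y) channel \<Rightarrow> ('x \<times> 'y) pmf" where
  "joint_pmf p V = bind_pmf p (\<lambda>x. map_pmf (Pair x) (V x))"

definition channel_information :: "'x pmf \<Rightarrow> ('x, 'y) channel \<Rightarrow> real" where
  "channel_information p V =
     prob_space.mutual_information (measure_pmf (joint_pmf p V)) 2
       (count_space UNIV) (count_space UNIV) fst snd"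

text \<open>
  The divergence $D(q \| p)$. The library's \<open>KL_divergence b M N\<close> takes the reference measure
  \<open>M\<close> first, is real-valued, and is meaningless unless \<open>N\<close> is absolutely
  continuous with respect to \<open>M\<close>.
\<close>

definition pmf_divergence :: "'a pmf \<Rightarrow> 'a pmf \<Rightarrow> ereal" where
  "pmf_divergence q p =
     (if absolutely_continuous (measure_pmf p) (measure_pmf q)
      then ereal (KL_divergence 2 (measure_pmf p) (measure_pmf q)) else \<infinity>)"

text \<open>
  $D(V \| W | p)$; inputs of probability zero contribute nothing, as \<open>0 * \<infinity> = 0\<close> in \<open>ereal\<close>.
\<close>

definition channel_divergence ::
    "('x::finite, 'y) channel \<Rightarrow> ('x, 'y) channel \<Rightarrow> 'x pmf \<Rightarrow> ereal" where
  "channel_divergence V W p = (\<Sum>x\<in>UNIV. ereal (pmf p x) * pmf_divergence (V x) (W x))"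

text \<open>
  Connectedness with respect to the Euclidean topology on matrices of transition probabilities
  (the product topology on \<open>'x \<Rightarrow> 'y \<Rightarrow> real\<close>, both index types being finite).
\<close>

definition connected_class :: "('x::finite, 'y::finite) channel set \<Rightarrow> bool" where
  "connected_class \<W> \<longleftrightarrow> connected ((\<lambda>W x y. pmf (W x) y) ` \<W>)"

definition compound_information :: "'x pmf \<Rightarrow> ('x, 'y) channel set \<Rightarrow> real" where
  "compound_information p \<W> = (INF W\<in>\<W>. channel_information p W)"

definition sphere_packing ::
    "real \<Rightarrow> 'x pmf \<Rightarrow> ('x::finite, 'y) channel \<Rightarrow> ereal" where
  "sphere_packing R p W = (INF V\<in>{V. channel_information p V \<le> R}. channel_divergence V W p)"

definition compound_sphere_packing ::
    "real \<Rightarrow> 'x pmf \<Rightarrow> ('x::finite, 'y) channel set \<Rightarrow> ereal" where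
  "compound_sphere_packing R p \<W> = (INF W\<in>\<W>. sphere_packing R p W)"

definition rate_interval :: "real \<Rightarrow> 'x pmf \<Rightarrow> real set" where
  "rate_interval R p = {- R .. pmf_entropy p - R}"

text \<open>
  The modified random coding exponents. Only the values of \<open>F\<close> on \<open>rate_interval R p\<close>
  matter; \<open>F\<close> is extended-real-valued because $|F^{-1}|^+$ may be infinite.
\<close>

definition random_coding ::
    "(real \<Rightarrow> ereal) \<Rightarrow> real \<Rightarrow> 'x pmf \<Rightarrow> ('x::finite, 'y) channel \<Rightarrow> ereal" where
  "random_coding F R p W =
     (INF V. channel_divergence V W p + F (channel_information p V - R))"

definition compound_random_coding ::
    "(real \<Rightarrow> ereal) \<Rightarrow> real \<Rightarrow> 'x pmf \<Rightarrow> ('x::finite, 'y) channel set \<Rightarrow> ereal" where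
  "compound_random_coding F R p \<W> = (INF W\<in>\<W>. random_coding F R p W)"

definition threshold_inverse :: "real \<Rightarrow> 'x pmf \<Rightarrow> (real \<Rightarrow> ereal) \<Rightarrow> real \<Rightarrow> ereal" where
  "threshold_inverse R p F u = Inf {ereal t | t. t \<in> rate_interval R p \<and> ereal u \<le> F t}"

definition pos_inverse :: "real \<Rightarrow> 'x pmf \<Rightarrow> (real \<Rightarrow> ereal) \<Rightarrow> real \<Rightarrow> ereal" where
  "pos_inverse R p F u = max 0 (threshold_inverse R p F u)"

definition threshold_class ::
    "real \<Rightarrow> 'x pmf \<Rightarrow> ('x::finite, 'y) channel set \<Rightarrow> real \<Rightarrow> (real \<Rightarrow> real) set" where
  "threshold_class R p \<W> \<alpha> =
     {F. continuous_on (rate_interval R p) F \<and> strict_mono_on (rate_interval R p) F \<and>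
         compound_random_coding (\<lambda>t. ereal (F t)) R p \<W> \<ge> ereal \<alpha>}"

definition erasure_exponent ::
    "real \<Rightarrow> 'x pmf \<Rightarrow> ('x::finite, 'y) channel set \<Rightarrow> real \<Rightarrow> ereal" where
  "erasure_exponent R p \<W> \<alpha> =
     (SUP F\<in>threshold_class R p \<W> \<alpha>.
        compound_random_coding (pos_inverse R p (\<lambda>t. ereal (F t))) R p \<W>)"

definition exponent_gap ::
    "real \<Rightarrow> 'x pmf \<Rightarrow> ('x::finite, 'y) channel set \<Rightarrow> real \<Rightarrow> ereal" where
  "exponent_gap R p \<W> \<alpha> = ereal \<alpha> - compound_sphere_packing R p \<W>"

definition constant_rule ::
    "real \<Rightarrow> 'x pmf \<Rightarrow> ('x::finite, 'y) channel set \<Rightarrow> real \<Rightarrow> real \<Rightarrow> ereal" where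
  "constant_rule R p \<W> \<alpha> = (\<lambda>t. exponent_gap R p \<W> \<alpha>)"

text \<open>
  A decoder with thresholding rule \<open>F\<close> has incorrect-message exponent $E_{r,F}$; the
  quantity $E_i(R,p,\mathscr W,\alpha)$ is this exponent for the constant rule.
\<close>

definition incorrect_message_exponent ::
    "real \<Rightarrow> 'x pmf \<Rightarrow> ('x::finite, 'y) channel set \<Rightarrow> real \<Rightarrow> ereal" where
  "incorrect_message_exponent R p \<W> \<alpha> =
     compound_random_coding (constant_rule R p \<W> \<alpha>) R p \<W>"

definition attains_min :: "('w \<Rightarrow> 'a::order) \<Rightarrow> 'w set \<Rightarrow> bool" where
  "attains_min f S \<longleftrightarrow> (\<exists>w. is_arg_min f (\<lambda>w. w \<in> S) w)"

text \<open>
  Attainment of the minima over the compound class: for the mutual information, for the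
  sphere-packing exponent, and for $E_{r,F}$ and $E_{r,|F^{-1}|^+}$ with \<open>F\<close> an admissible rule
  or the constant rule.
\<close>

definition minima_attained ::
    "real \<Rightarrow> 'x pmf \<Rightarrow> ('x::finite, 'y) channel set \<Rightarrow> real \<Rightarrow> bool" where
  "minima_attained R p \<W> \<alpha> \<longleftrightarrow>
     attains_min (channel_information p) \<W> \<and>
     attains_min (sphere_packing R p) \<W> \<and>
     (\<forall>F \<in> insert (constant_rule R p \<W> \<alpha>) ((\<lambda>F t. ereal (F t)) ` threshold_class R p \<W> \<alpha>).
        attains_min (random_coding F R p) \<W> \<and>
        attains_min (random_coding (pos_inverse R p F) R p) \<W>)"

end

theory Submission
  imports Defs
begin

text \<open>
  As the minimum defining $I(p,\mathscr W)$ is attained, some \<open>W \<in> \<W>\<close> has information at most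
  \<open>R\<close>, so that \<open>V = W\<close> makes the sphere-packing exponent vanish and the gap equals \<open>\<alpha>\<close>. At the
  pair \<open>V = W\<close> an admissible rule \<open>F\<close> takes a value \<open>F t \<ge> \<alpha> \<ge> 0 \<ge> t\<close> at
  \<open>t = I(p,W) - R\<close>, hence its inverse at \<open>t\<close> is at most \<open>t \<le> 0\<close>, which makes its erasure
  exponent zero. The supremum is zero rather than \<open>-\<infinity>\<close> because \<open>t \<mapsto> t + R + \<alpha>\<close> is admissible.
\<close>

text \<open>In the absolutely continuous case both distributions have their mass functions as
  densities with respect to counting measure, so Gibbs' inequality for densities applies.\<close>

lemma pmf_divergence_nonneg:
  fixes p q :: "'a::finite pmf"
  shows "0 \<le> pmf_divergence q p"
proof (cases "absolutely_continuous (measure_pmf p) (measure_pmf q)")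
  case True
  interpret C: sigma_finite_measure "count_space (UNIV :: 'a set)"
    by (rule sigma_finite_measure_count_space)
  \<comment> \<open>On singletons, absolute continuity says that the support of \<open>q\<close>
    lies in that of \<open>p\<close>.\<close>
  have ac: "pmf q x = 0" if "pmf p x = 0" for x
  proof -
    have "{x} \<in> null_sets (measure_pmf p)"
      using that by (auto simp: null_sets_def emeasure_pmf_single)
    then have "{x} \<in> null_sets (measure_pmf q)"
      using True by (auto simp: absolutely_continuous_def)
    then show ?thesis
      by (simp add: null_sets_def emeasure_pmf_single)
  qed
  have "0 \<le> KL_divergence 2 (density (count_space UNIV) (\<lambda>x. ennreal (pmf p x)))
                            (density (count_space UNIV) (\<lambda>x. ennreal (pmf q x)))"
    by (rule C.KL_density_density_nonneg)
      (auto simp: ac AE_count_space integrable_count_space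
        simp flip: measure_pmf_eq_density intro: prob_space_measure_pmf)
  then show ?thesis
    using True by (simp add: pmf_divergence_def flip: measure_pmf_eq_density)
qed (simp add: pmf_divergence_def)

lemma pmf_divergence_self [simp]: "pmf_divergence p p = 0"
  by (simp add: pmf_divergence_def absolutely_continuous_def
      sigma_finite_measure.KL_same_eq_0 prob_space_imp_sigma_finite prob_space_measure_pmf)

lemma channel_divergence_nonneg:
  fixes V W :: "('x::finite, 'y::finite) channel"
  shows "0 \<le> channel_divergence V W p"
  unfolding channel_divergence_def
  by (intro sum_nonneg mult_nonneg_nonneg) (simp_all add: pmf_divergence_nonneg)

lemma channel_divergence_self [simp]: "channel_divergence W W p = 0"
  by (simp add: channel_divergence_def)

lemma distributed_measure_pmf:
  "distributed (measure_pmf m) (count_space UNIV) X (\<lambda>x. ennreal (pmf (map_pmf X m) x))"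
  unfolding distributed_def
  by (auto simp flip: measure_pmf_eq_density simp: map_pmf_rep_eq)

text \<open>Over a finite range every function is integrable against counting measure, so the
  entropy integral converges.\<close>

lemma finite_entropy_measure_pmf:
  fixes X :: "'a \<Rightarrow> 'b::finite"
  assumes "1 < b"
  shows "information_space.finite_entropy (measure_pmf m) b (count_space UNIV) X
           (pmf (map_pmf X m))"
proof -
  interpret information_space "measure_pmf m" b
    using assms by unfold_locales
  show ?thesis
    by (simp add: finite_entropy_def distributed_measure_pmf integrable_count_space)
qed

text \<open>Mutual information is nonnegative once both marginals and the joint law have finite
  entropy. This keeps \<open>channel_information p V - R\<close> at or above the left end
  \<open>-R\<close> of the rate interval.\<close>

lemma channel_information_nonneg:
  fixes V :: "('x::finite, 'y::finite) channel"
  shows "0 \<le> channel_information p V"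
proof -
  interpret J: information_space "measure_pmf (joint_pmf p V)" 2
    by unfold_locales simp
  have prod: "count_space UNIV \<Otimes>\<^sub>M count_space UNIV = count_space (UNIV :: ('x \<times> 'y) set)"
    by (simp add: pair_measure_count_space)
  have joint: "J.finite_entropy (count_space UNIV \<Otimes>\<^sub>M count_space UNIV) (\<lambda>z. (fst z, snd z))
      (pmf (map_pmf (\<lambda>z. (fst z, snd z)) (joint_pmf p V)))"
    unfolding prod by (rule finite_entropy_measure_pmf) simp
  show ?thesis
    unfolding channel_information_def
    by (rule J.mutual_information_nonneg'[OF _ _ finite_entropy_measure_pmf finite_entropy_measure_pmf
          joint])
      (simp_all add: sigma_finite_measure_count_space)
qed

lemma compound_information_attained:
  assumes "attains_min (channel_information p) \<W>"
  obtains W where "W \<in> \<W>" "channel_information p W = compound_information p \<W>"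
proof -
  obtain W where W: "W \<in> \<W>" "\<And>V. V \<in> \<W> \<Longrightarrow> channel_information p W \<le> channel_information p V"
    using assms by (auto simp: attains_min_def is_arg_min_def not_less)
  then have "compound_information p \<W> = channel_information p W"
    unfolding compound_information_def by (intro cInf_eq_minimum) auto
  with W that show ?thesis
    by simp
qed

lemma compound_sphere_packing_eq_0:
  fixes \<W> :: "('x::finite, 'y::finite) channel set"
  assumes "W \<in> \<W>" "channel_information p W \<le> R"
  shows "compound_sphere_packing R p \<W> = 0"
proof (rule antisym)
  have "sphere_packing R p W \<le> channel_divergence W W p"
    unfolding sphere_packing_def by (rule INF_lower) (use assms in simp)
  then show "compound_sphere_packing R p \<W> \<le> 0"
    unfolding compound_sphere_packing_def by (simp add: INF_lower2[OF assms(1)])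
  show "0 \<le> compound_sphere_packing R p \<W>"
    unfolding compound_sphere_packing_def sphere_packing_def
    by (intro INF_greatest channel_divergence_nonneg)
qed

text \<open>Divergences are nonnegative, so a lower bound on \<open>F\<close> at the points that
  channels can reach survives both minimizations.\<close>

lemma compound_random_coding_greatest:
  fixes \<W> :: "('x::finite, 'y::finite) channel set"
  assumes "\<And>V :: ('x, 'y) channel. c \<le> F (channel_information p V - R)"
  shows "c \<le> compound_random_coding F R p \<W>"
  unfolding compound_random_coding_def random_coding_def
proof (intro INF_greatest)
  fix V W :: "('x, 'y) channel"
  show "c \<le> channel_divergence V W p + F (channel_information p V - R)"
    using add_mono[OF channel_divergence_nonneg assms] by simp
qed

text \<open>The choice \<open>V = W\<close> costs no divergence.\<close>

lemma compound_random_coding_le: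
  fixes \<W> :: "('x::finite, 'y::finite) channel set"
  assumes "W \<in> \<W>"
  shows "compound_random_coding F R p \<W> \<le> F (channel_information p W - R)"
proof -
  have "random_coding F R p W \<le> channel_divergence W W p + F (channel_information p W - R)"
    unfolding random_coding_def by (rule INF_lower) simp
  then show ?thesis
    unfolding compound_random_coding_def by (simp add: INF_lower2[OF assms])
qed

lemma compound_random_coding_const:
  fixes \<W> :: "('x::finite, 'y::finite) channel set"
  assumes "\<W> \<noteq> {}"
  shows "compound_random_coding (\<lambda>t. c) R p \<W> = c"
proof (rule antisym)
  obtain W where "W \<in> \<W>"
    using assms by blast
  from compound_random_coding_le[OF this, of "\<lambda>t. c"]
  show "compound_random_coding (\<lambda>t. c) R p \<W> \<le> c" .
qed (rule compound_random_coding_greatest, simp)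

text \<open>A sign condition at a single point covers both the admissible rules and the constant
  rule.\<close>

lemma compound_random_coding_pos_inverse_eq_0:
  fixes \<W> :: "('x::finite, 'y::finite) channel set"
  assumes W: "W \<in> \<W>" "channel_information p W \<le> R" and R: "R \<le> pmf_entropy p"
    and F: "0 \<le> F (channel_information p W - R)"
  shows "compound_random_coding (pos_inverse R p F) R p \<W> = 0"
proof (rule antisym)
  let ?t = "channel_information p W - R"
  \<comment> \<open>The upper end holds because \<open>?t\<close> is at most 0, which is at most
    \<open>pmf_entropy p - R\<close>.\<close>
  have "?t \<in> rate_interval R p"
    using W(2) R channel_information_nonneg[of p W] by (simp add: rate_interval_def)
  \<comment> \<open>Thus \<open>?t\<close> itself competes in the infimum defining the inverse at
    \<open>?t\<close>.\<close>
  moreover have "ereal ?t \<le> F ?t"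
    by (rule order_trans[OF _ F]) (use W(2) in simp)
  ultimately have "threshold_inverse R p F ?t \<le> ereal ?t"
    unfolding threshold_inverse_def by (intro Inf_lower) blast
  also have "ereal ?t \<le> 0"
    using W(2) by simp
  finally have "pos_inverse R p F ?t \<le> 0"
    by (simp add: pos_inverse_def)
  then show "compound_random_coding (pos_inverse R p F) R p \<W> \<le> 0"
    using compound_random_coding_le[OF W(1)] order_trans by blast
qed (rule compound_random_coding_greatest, simp add: pos_inverse_def)

text \<open>At \<open>t = channel_information p V - R\<close> the shift by \<open>R\<close> cancels,
  leaving information plus \<open>\<alpha>\<close>, which is at least
  \<open>\<alpha>\<close>.\<close>

lemma affine_in_threshold_class:
  fixes \<W> :: "('x::finite, 'y::finite) channel set"
  shows "(\<lambda>t. t + R + \<alpha>) \<in> threshold_class R p \<W> \<alpha>"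
  unfolding threshold_class_def
  by (auto intro!: continuous_intros strict_mono_onI compound_random_coding_greatest
      simp: channel_information_nonneg)

lemma erasure_exponent_eq_0:
  fixes \<W> :: "('x::finite, 'y::finite) channel set"
  assumes W: "W \<in> \<W>" "channel_information p W \<le> R" and R: "R \<le> pmf_entropy p"
    and "0 \<le> \<alpha>"
  shows "erasure_exponent R p \<W> \<alpha> = 0"
proof -
  have "compound_random_coding (pos_inverse R p (\<lambda>t. ereal (F t))) R p \<W> = 0"
    if "F \<in> threshold_class R p \<W> \<alpha>" for F
  proof (rule compound_random_coding_pos_inverse_eq_0[OF W R])
    have "0 \<le> ereal \<alpha>"
      using \<open>0 \<le> \<alpha>\<close> by simp
    also have "\<dots> \<le> compound_random_coding (\<lambda>t. ereal (F t)) R p \<W>"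
      using that by (simp add: threshold_class_def)
    also have "\<dots> \<le> ereal (F (channel_information p W - R))"
      by (rule compound_random_coding_le[OF W(1)])
    finally show "0 \<le> ereal (F (channel_information p W - R))" .
  qed
  then show ?thesis
    \<comment> \<open>The affine rule makes the index set nonempty, as the supremum of a constant
      family requires.\<close>
    unfolding erasure_exponent_def using affine_in_threshold_class[of R \<alpha> p \<W>]
    by (subst SUP_eq_const[where x = 0]) auto
qed

theorem corollary5p2:
  fixes p :: "'x::finite pmf"
    and \<W> :: "('x, 'y::finite) channel set"
    and R \<alpha> :: real
  assumes "0 < R" and "R \<le> pmf_entropy p"
    and "0 \<le> \<alpha>"
    and "\<W> \<noteq> {}" and "connected_class \<W>"
    and "minima_attained R p \<W> \<alpha>"
    and "compound_information p \<W> \<le> R"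
  shows "erasure_exponent R p \<W> \<alpha> =
           compound_random_coding (pos_inverse R p (constant_rule R p \<W> \<alpha>)) R p \<W> \<and>
         compound_random_coding (constant_rule R p \<W> \<alpha>) R p \<W> \<ge> ereal \<alpha> \<and>
         incorrect_message_exponent R p \<W> \<alpha> =
           compound_random_coding (constant_rule R p \<W> \<alpha>) R p \<W> \<and>
         compound_random_coding (constant_rule R p \<W> \<alpha>) R p \<W> = exponent_gap R p \<W> \<alpha> \<and>
         erasure_exponent R p \<W> \<alpha> = 0"
proof -
  \<comment> \<open>Attainment matters in the boundary case: an infimum equal to \<open>R\<close>
    need not by itself yield a channel with information at most \<open>R\<close>.\<close>
  obtain W where W: "W \<in> \<W>" "channel_information p W \<le> R"
    using assms(6,7) compound_information_attained unfolding minima_attained_def by metis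
  have gap: "exponent_gap R p \<W> \<alpha> = ereal \<alpha>"
    by (simp add: exponent_gap_def compound_sphere_packing_eq_0[OF W])
  have "compound_random_coding (constant_rule R p \<W> \<alpha>) R p \<W> = ereal \<alpha>"
    by (simp add: constant_rule_def gap compound_random_coding_const[OF assms(4)])
  moreover have "compound_random_coding (pos_inverse R p (constant_rule R p \<W> \<alpha>)) R p \<W> = 0"
    by (rule compound_random_coding_pos_inverse_eq_0[OF W assms(2)])
      (simp add: constant_rule_def gap assms(3))
  moreover have "erasure_exponent R p \<W> \<alpha> = 0"
    by (rule erasure_exponent_eq_0[OF W assms(2,3)])
  ultimately show ?thesis
    by (simp add: gap incorrect_message_exponent_def)
qed

end
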